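(* Let $H$ be a nonzero complex Hilbert space and, for $i=1,2$, let $X_i$ be a Banach space with respect to an $L(H)$-valued norm $F_i:X_i\to L(H)$. Define $F_1+F_2:X_1\oplus X_2\to L(H)$ on the algebraic direct sum by $$(F_1+F_2)(x_1\oplus x_2)=F_1(x_1)+F_2(x_2).$$ Then $X_1\oplus X_2$ is a Banach space with respect to $F_1+F_2$.
   Context: $L(H)$ denotes the bounded linear operators on $H$ with the operator norm, and $S\le T$ means that $T-S$ is a positive operator, where an operator $P$ is positive if $(Ph,h)\ge 0$ for all $h\in H$. $I_H$ is the identity operator on $H$. An $L(H)$-valued norm on a complex linear space $X$ is a function $F:X\to L(H)$ such that (1) $F(x)\ge 0$ for all $x$; (2) $F(x+y)\le F(x)+F(y)$ for all $x,y$; (3) $F(\lambda x)=|\lambda|F(x)$ for all $\lambda\in\mathbb{C}$, $x\in X$; (4) $F(x)=0$ if and only if $x=0$. A sequence $\{x_n\}$ in $X$ is Cauchy with respect to $F$ if for every $\epsilon>0$ there is $N(\epsilon)$ with $F(x_n-x_m)\le\epsilon I_H$ for all $n,m\ge N(\epsilon)$; it converges to $x\in X$ with respect to $F$ if for every $\epsilon>0$ there is $N(\epsilon)$ with $F(x_n-x)\le\epsilon I_H$ for all $n\ge N(\epsilon)$. $X$ is complete with respect to $F$ if every sequence that is Cauchy with respect to $F$ converges with respect to $F$ to an element of $X$. A Banach space with respect to $F$ is a complex linear space $X$ with an $L(H)$-valued norm $F:X\to L(H)$ such that $X$ is complete with respect to $F$. *)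

theory Defs
  imports "HOL-Analysis.Analysis"
begin

class complex_vector = ab_group_add +
  fixes scaleC :: "complex \<Rightarrow> 'a \<Rightarrow> 'a"  (infixr "*\<^sub>C" 75)
  assumes scaleC_add_right: "a *\<^sub>C (x + y) = a *\<^sub>C x + a *\<^sub>C y"
    and scaleC_add_left: "(a + b) *\<^sub>C x = a *\<^sub>C x + b *\<^sub>C x"
    and scaleC_scaleC: "a *\<^sub>C (b *\<^sub>C x) = (a * b) *\<^sub>C x"
    and scaleC_one: "1 *\<^sub>C x = x"

text \<open>The real normed structure inherited from the library is the one induced by the complex
  inner product, so that library notions such as \<open>blinfun\<close> and \<open>complete_space\<close> apply.
  The inner product is linear in its first argument.\<close>

class complex_inner = complex_vector + real_normed_vector +
  fixes cinner :: "'a \<Rightarrow> 'a \<Rightarrow> complex"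
  assumes scaleR_scaleC: "r *\<^sub>R x = complex_of_real r *\<^sub>C x"
    and cinner_add_left: "cinner (x + y) z = cinner x z + cinner y z"
    and cinner_scaleC_left: "cinner (a *\<^sub>C x) y = a * cinner x y"
    and cinner_commute: "cinner x y = cnj (cinner y x)"
    and cinner_nonneg: "cinner x x \<in> \<real>\<^sub>\<ge>\<^sub>0"
    and cinner_eq_zero_iff: "cinner x x = 0 \<longleftrightarrow> x = 0"
    and norm_eq_sqrt_cinner: "norm x = sqrt (Re (cinner x x))"

class complex_hilbert_space = complex_inner + complete_space

instantiation complex :: complex_hilbert_space
begin

definition scaleC_complex :: "complex \<Rightarrow> complex \<Rightarrow> complex"
  where "scaleC_complex a x = a * x"

definition cinner_complex :: "complex \<Rightarrow> complex \<Rightarrow> complex"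
  where "cinner_complex x y = x * cnj y"

instance
proof
  fix x :: complex
  show "cinner x x \<in> \<real>\<^sub>\<ge>\<^sub>0"
    by (simp add: cinner_complex_def complex_nonneg_Reals_iff)
  show "norm x = sqrt (Re (cinner x x))"
    by (simp add: cinner_complex_def cmod_def power2_eq_square)
qed (simp_all add: scaleC_complex_def cinner_complex_def scaleR_conv_of_real algebra_simps)

end

text \<open>The algebraic direct sum of two complex linear spaces is the product type.\<close>

instantiation prod :: (complex_vector, complex_vector) complex_vector
begin

definition scaleC_prod :: "complex \<Rightarrow> 'a \<times> 'b \<Rightarrow> 'a \<times> 'b"
  where "scaleC_prod a z = (a *\<^sub>C fst z, a *\<^sub>C snd z)"

instance
  by standard
    (simp_all add: scaleC_prod_def scaleC_add_right scaleC_add_left scaleC_scaleC scaleC_one)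

end

text \<open>The library type \<open>'h \<Rightarrow>\<^sub>L 'h\<close> consists of the bounded real-linear operators;
  \<open>L(H)\<close> is its subset of complex-linear ones.\<close>

definition bounded_clinear_ops :: "('h::complex_inner \<Rightarrow>\<^sub>L 'h) set"
  where "bounded_clinear_ops =
    {T. \<forall>a h. blinfun_apply T (a *\<^sub>C h) = a *\<^sub>C blinfun_apply T h}"

definition positive_op :: "('h::complex_inner \<Rightarrow>\<^sub>L 'h) \<Rightarrow> bool"
  where "positive_op P \<longleftrightarrow> (\<forall>h. cinner (blinfun_apply P h) h \<in> \<real>\<^sub>\<ge>\<^sub>0)"

definition op_le :: "('h::complex_inner \<Rightarrow>\<^sub>L 'h) \<Rightarrow> ('h \<Rightarrow>\<^sub>L 'h) \<Rightarrow> bool"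
    (infix "\<preceq>" 50)
  where "S \<preceq> T \<longleftrightarrow> positive_op (T - S)"

definition op_valued_norm ::
    "('x::complex_vector \<Rightarrow> ('h::complex_inner \<Rightarrow>\<^sub>L 'h)) \<Rightarrow> bool"
  where "op_valued_norm F \<longleftrightarrow>
    range F \<subseteq> bounded_clinear_ops \<and>
    (\<forall>x. 0 \<preceq> F x) \<and>
    (\<forall>x y. F (x + y) \<preceq> F x + F y) \<and>
    (\<forall>a x. F (a *\<^sub>C x) = cmod a *\<^sub>R F x) \<and>
    (\<forall>x. F x = 0 \<longleftrightarrow> x = 0)"

definition Cauchy_wrt ::
    "('x::complex_vector \<Rightarrow> ('h::complex_inner \<Rightarrow>\<^sub>L 'h)) \<Rightarrow> (nat \<Rightarrow> 'x) \<Rightarrow> bool"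
  where "Cauchy_wrt F u \<longleftrightarrow>
    (\<forall>\<epsilon>>0. \<exists>N. \<forall>n\<ge>N. \<forall>m\<ge>N. F (u n - u m) \<preceq> \<epsilon> *\<^sub>R id_blinfun)"

definition converges_wrt ::
    "('x::complex_vector \<Rightarrow> ('h::complex_inner \<Rightarrow>\<^sub>L 'h)) \<Rightarrow> (nat \<Rightarrow> 'x) \<Rightarrow> 'x \<Rightarrow> bool"
  where "converges_wrt F u x \<longleftrightarrow>
    (\<forall>\<epsilon>>0. \<exists>N. \<forall>n\<ge>N. F (u n - x) \<preceq> \<epsilon> *\<^sub>R id_blinfun)"

definition complete_wrt ::
    "('x::complex_vector \<Rightarrow> ('h::complex_inner \<Rightarrow>\<^sub>L 'h)) \<Rightarrow> bool"
  where "complete_wrt F \<longleftrightarrow> (\<forall>u. Cauchy_wrt F u \<longrightarrow> (\<exists>x. converges_wrt F u x))"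

definition Banach_space_wrt ::
    "('x::complex_vector \<Rightarrow> ('h::complex_inner \<Rightarrow>\<^sub>L 'h)) \<Rightarrow> bool"
  where "Banach_space_wrt F \<longleftrightarrow> op_valued_norm F \<and> complete_wrt F"

definition direct_sum_norm ::
    "('x \<Rightarrow> ('h::complex_inner \<Rightarrow>\<^sub>L 'h)) \<Rightarrow> ('y \<Rightarrow> ('h \<Rightarrow>\<^sub>L 'h)) \<Rightarrow>
      'x \<times> 'y \<Rightarrow> ('h \<Rightarrow>\<^sub>L 'h)"
  where "direct_sum_norm F\<^sub>1 F\<^sub>2 = (\<lambda>(x\<^sub>1, x\<^sub>2). F\<^sub>1 x\<^sub>1 + F\<^sub>2 x\<^sub>2)"

end

theory Submission
  imports Defs
begin

text \<open>Both summands of \<open>F\<^sub>1 x + F\<^sub>2 y\<close> are positive, so each of them lies below the sum in the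
  operator order (\<open>op_le_add_right\<close>, \<open>op_le_add_left\<close>). This has two consequences. First, if the sum
  is \<open>0\<close> then each summand is both \<open>\<succeq> 0\<close> and \<open>\<preceq> 0\<close>, hence \<open>0\<close> by antisymmetry of the order
  (\<open>op_le_antisym\<close>), which gives definiteness; the other norm axioms add up componentwise.
  Secondly, a bound \<open>\<epsilon> I\<close> on the sum is a bound on each summand, so the components of a Cauchy
  sequence are Cauchy. Their limits exist by completeness, and bounds \<open>(\<epsilon>/2) I\<close> on both components
  add up to a bound \<open>\<epsilon> I\<close> on the sum.

  The only step that is not formal is antisymmetry. It rests on polarization: a complex-linear
  operator whose quadratic form \<open>(Th, h)\<close> vanishes is \<open>0\<close>.\<close>

lemma cinner_add_right: "cinner x (y + z) = cinner x y + cinner x (z::'h::complex_inner)"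
  by (simp add: cinner_commute[of x] cinner_add_left)

lemma cinner_scaleC_right: "cinner x (a *\<^sub>C y) = cnj a * cinner x (y::'h::complex_inner)"
  by (simp add: cinner_commute[of x] cinner_scaleC_left)

lemma cinner_minus_left: "cinner (- x) y = - cinner x (y::'h::complex_inner)"
  using cinner_add_left[of x "- x" y] cinner_add_left[of 0 0 y]
  by (simp add: eq_neg_iff_add_eq_0 add.commute)

text \<open>Vanishing of the form on \<open>h + k\<close> yields \<open>(Th, k) + (Tk, h) = 0\<close>, and on \<open>h + \<i>k\<close> it yields
  \<open>(Tk, h) - (Th, k) = 0\<close>, so \<open>(Th, k) = 0\<close> for all \<open>k\<close>; then \<open>k = Th\<close> finishes. The minus sign
  comes from \<open>T(\<i>k) = \<i>Tk\<close>: the real-linear map \<open>(a, b) \<mapsto> (- cnj b, cnj a)\<close> on \<open>\<complex>\<^sup>2\<close> is nonzero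
  with vanishing form.\<close>
lemma quadratic_form_zero_imp_zero:
  fixes T :: "'h::complex_inner \<Rightarrow>\<^sub>L 'h"
  assumes lin: "T \<in> bounded_clinear_ops"
    and zero: "\<And>h. cinner (blinfun_apply T h) h = 0"
  shows "T = 0"
proof (rule blinfun_eqI)
  fix h
  have cross: "cinner (blinfun_apply T h) k + cinner (blinfun_apply T k) h = 0" for k
    using zero[of "h + k"] zero[of h] zero[of k]
    by (simp add: blinfun.add_right cinner_add_left cinner_add_right add.commute)
  have "cinner (blinfun_apply T h) k = 0" for k
  proof -
    have "blinfun_apply T (\<i> *\<^sub>C k) = \<i> *\<^sub>C blinfun_apply T k"
      using lin by (simp add: bounded_clinear_ops_def)
    then have "\<i> * (cinner (blinfun_apply T k) h - cinner (blinfun_apply T h) k) = 0"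
      using cross[of "\<i> *\<^sub>C k"]
      by (simp add: cinner_scaleC_left cinner_scaleC_right algebra_simps)
    then have "cinner (blinfun_apply T k) h = cinner (blinfun_apply T h) k"
      by simp
    with cross[of k] show ?thesis by simp
  qed
  from this[of "blinfun_apply T h"] show "blinfun_apply T h = blinfun_apply 0 h"
    by (simp add: cinner_eq_zero_iff)
qed

lemma positive_op_add: "positive_op S \<Longrightarrow> positive_op T \<Longrightarrow> positive_op (S + T)"
  by (simp add: positive_op_def blinfun.add_left cinner_add_left)

lemma op_le_trans: "R \<preceq> S \<Longrightarrow> S \<preceq> T \<Longrightarrow> R \<preceq> T"
  using positive_op_add[of "S - R" "T - S"] by (simp add: op_le_def)

lemma op_le_add_mono: "S \<preceq> T \<Longrightarrow> S' \<preceq> T' \<Longrightarrow> S + S' \<preceq> T + T'"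
  using positive_op_add[of "T - S" "T' - S'"] by (simp add: op_le_def algebra_simps)

lemma op_le_add_right: "0 \<preceq> T \<Longrightarrow> S \<preceq> S + T"
  by (simp add: op_le_def)

lemma op_le_add_left: "0 \<preceq> T \<Longrightarrow> S \<preceq> T + S"
  by (simp add: op_le_def)

lemma bounded_clinear_ops_add:
  "S \<in> bounded_clinear_ops \<Longrightarrow> T \<in> bounded_clinear_ops \<Longrightarrow> S + T \<in> bounded_clinear_ops"
  by (simp add: bounded_clinear_ops_def blinfun.add_left scaleC_add_right)

lemma scaleC_minus_right: "a *\<^sub>C (- x) = - (a *\<^sub>C (x::'a::complex_vector))"
proof -
  have "a *\<^sub>C (0::'a) = 0"
    using scaleC_add_right[of a 0 "0::'a"] by simp
  then have "a *\<^sub>C x + a *\<^sub>C (- x) = 0"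
    using scaleC_add_right[of a x "- x"] by simp
  then show ?thesis by (rule minus_unique[symmetric])
qed

lemma bounded_clinear_ops_diff:
  "S \<in> bounded_clinear_ops \<Longrightarrow> T \<in> bounded_clinear_ops \<Longrightarrow> S - T \<in> bounded_clinear_ops"
  unfolding diff_conv_add_uminus
  by (rule bounded_clinear_ops_add)
    (simp_all add: bounded_clinear_ops_def blinfun.minus_left scaleC_minus_right)

lemma op_le_antisym:
  fixes S T :: "'h::complex_inner \<Rightarrow>\<^sub>L 'h"
  assumes "S \<in> bounded_clinear_ops" "T \<in> bounded_clinear_ops" "S \<preceq> T" "T \<preceq> S"
  shows "S = T"
proof -
  have "cinner (blinfun_apply (S - T) h) h = 0" for h
  proof -
    have "cinner (blinfun_apply (S - T) h) h \<in> \<real>\<^sub>\<ge>\<^sub>0"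
      using assms(4) by (simp add: op_le_def positive_op_def)
    moreover have "- cinner (blinfun_apply (S - T) h) h \<in> \<real>\<^sub>\<ge>\<^sub>0"
    proof -
      have "T - S = - (S - T)" by simp
      then show ?thesis
        using assms(3) unfolding op_le_def positive_op_def
        by (simp only: blinfun.minus_left cinner_minus_left)
    qed
    ultimately show ?thesis
      by (simp add: complex_nonneg_Reals_iff complex_eq_iff)
  qed
  then have "S - T = 0"
    using assms(1,2) by (blast intro: quadratic_form_zero_imp_zero bounded_clinear_ops_diff)
  then show ?thesis by simp
qed

text \<open>The order-theoretic reason for definiteness of the direct sum norm: positive operators do not
  cancel.\<close>
lemma sum_of_positive_eq_zero_iff:
  fixes S T :: "'h::complex_inner \<Rightarrow>\<^sub>L 'h"
  assumes "S \<in> bounded_clinear_ops" "T \<in> bounded_clinear_ops" "0 \<preceq> S" "0 \<preceq> T"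
  shows "S + T = 0 \<longleftrightarrow> S = 0 \<and> T = 0"
proof
  assume sum: "S + T = 0"
  have "S \<preceq> 0" "T \<preceq> 0"
    using op_le_add_right[OF assms(4), of S] op_le_add_left[OF assms(3), of T] sum by simp_all
  moreover have "(0 :: 'h \<Rightarrow>\<^sub>L 'h) \<in> bounded_clinear_ops"
    using bounded_clinear_ops_diff[OF assms(1) assms(1)] by simp
  ultimately show "S = 0 \<and> T = 0"
    using assms op_le_antisym by blast
qed simp

lemma op_valued_norm_direct_sum:
  assumes "op_valued_norm F" and "op_valued_norm G"
  shows "op_valued_norm (direct_sum_norm F G)"
proof -
  have lin: "F x \<in> bounded_clinear_ops" "G y \<in> bounded_clinear_ops"
    and pos: "0 \<preceq> F x" "0 \<preceq> G y"
    and hom: "F (a *\<^sub>C x) = cmod a *\<^sub>R F x" "G (a *\<^sub>C y) = cmod a *\<^sub>R G y"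
    and zero: "F x = 0 \<longleftrightarrow> x = 0" "G y = 0 \<longleftrightarrow> y = 0" for a x y
    using assms unfolding op_valued_norm_def image_subset_iff by simp_all
  have tri: "F (x + x') \<preceq> F x + F x'" "G (y + y') \<preceq> G y + G y'" for x x' y y'
    using assms unfolding op_valued_norm_def by simp_all
  have "F (x + x') + G (y + y') \<preceq> (F x + G y) + (F x' + G y')" for x x' y y'
    using op_le_add_mono[OF tri, of x x' y y'] by (simp add: ac_simps)
  moreover have "F x + G y = 0 \<longleftrightarrow> x = 0 \<and> y = 0" for x y
    using sum_of_positive_eq_zero_iff[OF lin pos] by (simp add: zero)
  moreover have "0 \<preceq> F x + G y" for x y
    using op_le_trans[OF pos(1) op_le_add_right[OF pos(2)]] .
  moreover have "F x + G y \<in> bounded_clinear_ops" for x y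
    using lin by (rule bounded_clinear_ops_add)
  ultimately show ?thesis
    by (simp add: op_valued_norm_def direct_sum_norm_def scaleC_prod_def scaleR_add_right
        zero_prod_def split_beta image_subset_iff hom prod_eq_iff)
qed

text \<open>Applied with \<open>v\<close> a component of \<open>u\<close>: the direct sum norm of a difference dominates the norms
  of both component differences.\<close>
lemma Cauchy_wrt_dominated:
  assumes "Cauchy_wrt F u" and "\<And>n m. G (v n - v m) \<preceq> F (u n - u m)"
  shows "Cauchy_wrt G v"
  using assms unfolding Cauchy_wrt_def by (meson op_le_trans)

lemma converges_wrt_direct_sum:
  assumes "converges_wrt F (\<lambda>n. fst (u n)) x" and "converges_wrt G (\<lambda>n. snd (u n)) y"
  shows "converges_wrt (direct_sum_norm F G) u (x, y)"
  unfolding converges_wrt_def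
proof (intro allI impI)
  fix \<epsilon> :: real
  assume "\<epsilon> > 0"
  then have "\<epsilon> / 2 > 0" by simp
  then obtain M N where
    M: "\<And>n. n \<ge> M \<Longrightarrow> F (fst (u n) - x) \<preceq> (\<epsilon> / 2) *\<^sub>R id_blinfun" and
    N: "\<And>n. n \<ge> N \<Longrightarrow> G (snd (u n) - y) \<preceq> (\<epsilon> / 2) *\<^sub>R id_blinfun"
    using assms unfolding converges_wrt_def by meson
  have "direct_sum_norm F G (u n - (x, y)) \<preceq> \<epsilon> *\<^sub>R id_blinfun" if "n \<ge> max M N" for n
    using op_le_add_mono[OF M N, of n n] that
    by (simp add: direct_sum_norm_def split_beta flip: scaleR_add_left)
  then show "\<exists>N. \<forall>n\<ge>N. direct_sum_norm F G (u n - (x, y)) \<preceq> \<epsilon> *\<^sub>R id_blinfun"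
    by blast
qed

lemma complete_wrt_direct_sum:
  assumes pos: "\<And>x. 0 \<preceq> F x" "\<And>y. 0 \<preceq> G y"
    and "complete_wrt F" and "complete_wrt G"
  shows "complete_wrt (direct_sum_norm F G)"
  unfolding complete_wrt_def
proof (intro allI impI)
  fix u
  assume u: "Cauchy_wrt (direct_sum_norm F G) u"
  have "Cauchy_wrt F (\<lambda>n. fst (u n))"
    using u by (rule Cauchy_wrt_dominated)
      (simp add: direct_sum_norm_def split_beta op_le_add_right pos)
  then obtain x where "converges_wrt F (\<lambda>n. fst (u n)) x"
    using assms(3) unfolding complete_wrt_def by blast
  moreover have "Cauchy_wrt G (\<lambda>n. snd (u n))"
    using u by (rule Cauchy_wrt_dominated)
      (simp add: direct_sum_norm_def split_beta op_le_add_left pos)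
  then obtain y where "converges_wrt G (\<lambda>n. snd (u n)) y"
    using assms(4) unfolding complete_wrt_def by blast
  ultimately show "\<exists>z. converges_wrt (direct_sum_norm F G) u z"
    using converges_wrt_direct_sum by blast
qed

theorem theorem2p7:
  fixes F\<^sub>1 :: "'x::complex_vector \<Rightarrow> ('h::complex_hilbert_space \<Rightarrow>\<^sub>L 'h)"
    and F\<^sub>2 :: "'y::complex_vector \<Rightarrow> ('h \<Rightarrow>\<^sub>L 'h)"
  assumes "\<exists>h::'h. h \<noteq> 0"
    and "Banach_space_wrt F\<^sub>1"
    and "Banach_space_wrt F\<^sub>2"
  shows "Banach_space_wrt (direct_sum_norm F\<^sub>1 F\<^sub>2)"
proof -
  have "op_valued_norm F\<^sub>1" "op_valued_norm F\<^sub>2" "complete_wrt F\<^sub>1" "complete_wrt F\<^sub>2"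
    using assms(2,3) by (simp_all add: Banach_space_wrt_def)
  then show ?thesis
    unfolding Banach_space_wrt_def
    by (intro conjI op_valued_norm_direct_sum complete_wrt_direct_sum)
      (auto simp: op_valued_norm_def)
qed

end
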